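(* Let $M$ be a monoid equipped with an arbitrary topology $\tau$, let $V:\mathrm{Cont}(M,\tau)\to\mathrm{PSh}(M)$ be the forgetful functor and $R$ its right adjoint. Consider the power set $\mathcal{P}(M)$ equipped with the inverse image action. Then the underlying set of $$T:=VR(\mathcal{P}(M))=\{A\subseteq M\mid \forall p,q\in M,\ \mathcal{I}^p_{q^*(A)}\in\tau\}$$ is a base of clopen sets for a topology $\tilde\tau\subseteq\tau$ such that $\mathrm{Cont}(M,\tilde\tau)=\mathrm{Cont}(M,\tau)$ as subcategories of $\mathrm{PSh}(M)$. Moreover, $\tilde\tau$ is the coarsest topology on $M$ with this property.
   Context: $\mathrm{PSh}(M)$ is the category of right $M$-sets. The topology $\tau$ is not assumed to make multiplication continuous. An $(M,\tau)$-set is a right $M$-set $X$ whose action $X\times M\to X$ is continuous when $X$ is given the discrete topology; $\mathrm{Cont}(M,\tau)$ is the full subcategory of $\mathrm{PSh}(M)$ on the $(M,\tau)$-sets. For a right $M$-set $X$, $x\in X$, $p\in M$, put $\mathcal{I}_x^p=\{m\in M\mid xm=xp\}$; the right adjoint $R$ of $V$ is $R(X)=\{x\in X\mid\forall p,q\in M,\ \mathcal{I}_{xq}^p\in\tau\}$. The inverse image action is the right action of $M$ on $\mathcal{P}(M)$ given by $A\cdot g=g^*(A)=\{x\in M\mid gx\in A\}$; thus for $A\subseteq M$, $\mathcal{I}_A^p=\{m\in M\mid m^*(A)=p^*(A)\}$. *)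

theory Defs
  imports "HOL-Analysis.Analysis"
begin

record ('x, 'm) mset =
  points :: "'x set"
  act :: "'x \<Rightarrow> 'm \<Rightarrow> 'x"

definition right_mset :: "('x, 'm::monoid_mult) mset \<Rightarrow> bool" where
  "right_mset X \<longleftrightarrow>
     (\<forall>x\<in>points X. \<forall>m. act X x m \<in> points X) \<and>
     (\<forall>x\<in>points X. act X x 1 = x) \<and>
     (\<forall>x\<in>points X. \<forall>m n. act X (act X x m) n = act X x (m * n))"

definition equivariant_maps ::
    "('x, 'm::monoid_mult) mset \<Rightarrow> ('y, 'm) mset \<Rightarrow> ('x \<Rightarrow> 'y) set" where
  "equivariant_maps X Y =
     {f \<in> points X \<rightarrow>\<^sub>E points Y. \<forall>x\<in>points X. \<forall>m. f (act X x m) = act Y (f x) m}"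

text \<open>A topology on the monoid \<open>'m\<close> is a \<^typ>\<open>'m topology\<close> whose \<^const>\<open>topspace\<close> is
  \<^const>\<open>UNIV\<close>. It need not make multiplication continuous.\<close>

definition continuous_mset :: "'m::monoid_mult topology \<Rightarrow> ('x, 'm) mset \<Rightarrow> bool" where
  "continuous_mset \<tau> X \<longleftrightarrow>
     right_mset X \<and>
     continuous_map (prod_topology (discrete_topology (points X)) \<tau>)
       (discrete_topology (points X)) (\<lambda>(x, m). act X x m)"

text \<open>A subcategory of the category of right \<open>'m\<close>-sets with points in the type \<open>'x\<close> is
  represented by its objects and its morphisms, the latter as triples of domain, map and
  codomain; identities and composition are those of functions. The type \<open>'x\<close> plays the role
  of the universe of sets; for the power set of \<open>'m\<close> to be among these \<open>'m\<close>-sets (up to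
  isomorphism) there must be an injection from \<^typ>\<open>'m set\<close> into \<open>'x\<close>.\<close>

type_synonym ('x, 'm) subcat =
  "('x, 'm) mset set \<times> (('x, 'm) mset \<times> ('x \<Rightarrow> 'x) \<times> ('x, 'm) mset) set"

definition full_subcat :: "('x, 'm::monoid_mult) mset set \<Rightarrow> ('x, 'm) subcat" where
  "full_subcat C = (C, {(X, f, Y). X \<in> C \<and> Y \<in> C \<and> f \<in> equivariant_maps X Y})"

definition Cont :: "'m::monoid_mult topology \<Rightarrow> ('x, 'm) subcat" where
  "Cont \<tau> = full_subcat {X. continuous_mset \<tau> X}"

text \<open>The set \<open>\<I>\<^sub>x\<^sup>p\<close>.\<close>

definition stab :: "('x, 'm::monoid_mult) mset \<Rightarrow> 'x \<Rightarrow> 'm \<Rightarrow> 'm set" where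
  "stab X x p = {m. act X x m = act X x p}"

text \<open>The functor \<open>R\<close> on objects. That it is right adjoint to the forgetful functor \<open>V\<close>
  (which does not change the underlying \<open>'m\<close>-set), with the inclusion as counit, is shown in
  \<open>R_continuous\<close> and \<open>R_adjoint\<close> below.\<close>

definition R_obj :: "'m::monoid_mult topology \<Rightarrow> ('x, 'm) mset \<Rightarrow> ('x, 'm) mset" where
  "R_obj \<tau> X =
     \<lparr>points = {x \<in> points X. \<forall>p q. openin \<tau> (stab X (act X x q) p)}, act = act X\<rparr>"

definition preimage_act :: "'m::monoid_mult \<Rightarrow> 'm set \<Rightarrow> 'm set" where
  "preimage_act g A = {x. g * x \<in> A}"

definition powerset_mset :: "('m set, 'm::monoid_mult) mset" where
  "powerset_mset = \<lparr>points = UNIV, act = (\<lambda>A g. preimage_act g A)\<rparr>"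

lemma right_mset_powerset: "right_mset (powerset_mset :: ('m set, 'm::monoid_mult) mset)"
  by (auto simp: right_mset_def powerset_mset_def preimage_act_def mult.assoc)

lemma continuous_mset_iff:
  fixes \<tau> :: "'m::monoid_mult topology"
  assumes "topspace \<tau> = UNIV"
  shows "continuous_mset \<tau> X \<longleftrightarrow>
    right_mset X \<and> (\<forall>x\<in>points X. \<forall>p. openin \<tau> (stab X x p))"
proof (cases "right_mset X")
  case X: True
  let ?P = "prod_topology (discrete_topology (points X)) \<tau>"
  have "continuous_map ?P (discrete_topology (points X)) (\<lambda>(x, m). act X x m) \<longleftrightarrow>
      (\<forall>x\<in>points X. \<forall>p. openin \<tau> (stab X x p))"
  proof
    assume c: "continuous_map ?P (discrete_topology (points X)) (\<lambda>(x, m). act X x m)"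
    show "\<forall>x\<in>points X. \<forall>p. openin \<tau> (stab X x p)"
    proof (intro ballI allI)
      fix x p assume x: "x \<in> points X"
      have "continuous_map \<tau> ?P (\<lambda>m. (x, m))"
        using x by (simp add: continuous_map_pairwise o_def)
      from continuous_map_compose[OF this c]
      have "continuous_map \<tau> (discrete_topology (points X)) (\<lambda>m. act X x m)"
        by (simp add: o_def)
      moreover have "openin (discrete_topology (points X)) {act X x p}"
        using X x by (simp add: right_mset_def)
      ultimately have "openin \<tau> {m \<in> topspace \<tau>. act X x m \<in> {act X x p}}"
        by (rule openin_continuous_map_preimage)
      then show "openin \<tau> (stab X x p)"
        by (simp add: assms stab_def)
    qed
  next
    assume o: "\<forall>x\<in>points X. \<forall>p. openin \<tau> (stab X x p)"
    show "continuous_map ?P (discrete_topology (points X)) (\<lambda>(x, m). act X x m)"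
      unfolding continuous_map_def
    proof (intro conjI allI impI)
      show "(\<lambda>(x, m). act X x m) \<in> topspace ?P \<rightarrow> topspace (discrete_topology (points X))"
        using X by (auto simp: right_mset_def)
    next
      fix U
      have "openin ?P (\<Union>(x, p)\<in>{(x, p). x \<in> points X \<and> act X x p \<in> U}. {x} \<times> stab X x p)"
        using o by (intro openin_Union) (auto simp: openin_prod_Times_iff)
      moreover have "{z \<in> topspace ?P. (case z of (x, m) \<Rightarrow> act X x m) \<in> U} =
          (\<Union>(x, p)\<in>{(x, p). x \<in> points X \<and> act X x p \<in> U}. {x} \<times> stab X x p)"
        by (auto simp: assms stab_def)
      ultimately show "openin ?P {z \<in> topspace ?P. (case z of (x, m) \<Rightarrow> act X x m) \<in> U}"
        by simp
    qed
  qed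
  then show ?thesis
    by (simp add: continuous_mset_def)
qed (simp add: continuous_mset_def)

lemma R_continuous:
  assumes "topspace \<tau> = UNIV" and X: "right_mset X"
  shows "continuous_mset \<tau> (R_obj \<tau> X)"
proof -
  have "openin \<tau> (stab X x p)" if "x \<in> points (R_obj \<tau> X)" for x p
  proof -
    have "openin \<tau> (stab X (act X x 1) p)"
      using that by (simp add: R_obj_def)
    then show ?thesis
      using that X by (simp add: R_obj_def right_mset_def)
  qed
  moreover have "right_mset (R_obj \<tau> X)"
    using X by (auto simp: R_obj_def right_mset_def)
  ultimately show ?thesis
    by (simp add: continuous_mset_iff[OF assms(1)] stab_def R_obj_def)
qed

lemma R_adjoint:
  fixes X :: "('x, 'm::monoid_mult) mset" and Y :: "('y, 'm) mset"
  assumes "topspace \<tau> = UNIV" and "continuous_mset \<tau> Y" and "right_mset X"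
  shows "equivariant_maps Y (R_obj \<tau> X) = equivariant_maps Y X"
proof
  show "equivariant_maps Y (R_obj \<tau> X) \<subseteq> equivariant_maps Y X"
    by (auto simp: equivariant_maps_def R_obj_def PiE_iff)
next
  have Y: "right_mset Y" and o: "\<And>y p. y \<in> points Y \<Longrightarrow> openin \<tau> (stab Y y p)"
    using assms by (auto simp: continuous_mset_iff)
  have cl: "act Y y m \<in> points Y" if "y \<in> points Y" for y m
    using Y that by (simp add: right_mset_def)
  have "f y \<in> points (R_obj \<tau> X)" if f: "f \<in> equivariant_maps Y X" and y: "y \<in> points Y" for f y
  proof -
    have eq: "act X (f z) m = f (act Y z m)" if "z \<in> points Y" for z m
      using f that by (simp add: equivariant_maps_def)
    have "openin \<tau> (stab X (f z) p)" if z: "z \<in> points Y" for z p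
    proof -
      have "stab X (f z) p = (\<Union>r\<in>stab X (f z) p. stab Y z r)"
        using z by (auto simp: stab_def eq)
      then show ?thesis
        using o[OF z] by (metis (no_types, lifting) openin_Union imageE)
    qed
    then show ?thesis
      using f y cl by (auto simp: R_obj_def eq equivariant_maps_def)
  qed
  then show "equivariant_maps Y X \<subseteq> equivariant_maps Y (R_obj \<tau> X)"
    by (auto simp: equivariant_maps_def R_obj_def PiE_iff)
qed

end

theory Submission imports Defs begin

text \<open>Every \<open>A\<close> in \<open>T\<close> is the union of the open sets \<open>\<I>\<^sub>A\<^sup>p\<close> with \<open>p \<in> A\<close>, because
  \<open>m \<in> A\<close> iff \<open>1 \<in> m\<^sup>*(A)\<close>; hence the topology generated by \<open>T\<close> is contained in \<open>\<tau>\<close>, and also in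
  every topology that makes the \<open>M\<close>-set \<open>T\<close> itself continuous. Conversely, each set \<open>\<I>\<^sub>x\<^sup>p\<close> of a
  continuous \<open>M\<close>-set belongs to \<open>T\<close>, since \<open>m\<^sup>*(q\<^sup>*(\<I>\<^sub>x\<^sup>p))\<close> depends only on \<open>xqm\<close>; so passing to the
  coarser topology loses no continuous \<open>M\<close>-set.\<close>

lemma preimage_act_comp: "preimage_act m (preimage_act q A) = preimage_act (q * m) A"
  by (simp add: preimage_act_def mult.assoc)

lemma one_in_preimage_act [simp]: "1 \<in> preimage_act m A \<longleftrightarrow> m \<in> A"
  by (simp add: preimage_act_def)

lemma points_R_powerset:
  "points (R_obj \<tau> powerset_mset) = {A. \<forall>p q. openin \<tau>
     {m. preimage_act m (preimage_act q A) = preimage_act p (preimage_act q A)}}"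
  by (simp add: R_obj_def powerset_mset_def stab_def)

text \<open>The set is empty or, for any \<open>p\<close> in it, equals the fibre through
  \<open>p\<close>, which is open by membership of \<open>A\<close>. So \<open>r\<close> may be any
  element, not only a multiple of \<open>q\<close>.\<close>

lemma R_powersetD:
  assumes "A \<in> points (R_obj \<tau> powerset_mset)"
  shows "openin \<tau> {m. preimage_act (q * m) A = preimage_act r A}"
proof (subst openin_subopen, intro ballI)
  fix p assume "p \<in> {m. preimage_act (q * m) A = preimage_act r A}"
  then have p: "preimage_act (q * p) A = preimage_act r A"
    by simp
  have "openin \<tau> {m. preimage_act (q * m) A = preimage_act (q * p) A}"
    using assms by (simp add: points_R_powerset preimage_act_comp)
  then show "\<exists>U. openin \<tau> U \<and> p \<in> U \<and> U \<subseteq> {m. preimage_act (q * m) A = preimage_act r A}"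
    using p by auto
qed

text \<open>Local form of membership: a map is locally constant exactly when its fibres are
  open.\<close>

lemma R_powersetI:
  assumes "\<And>p q. \<exists>U. openin \<tau> U \<and> p \<in> U \<and>
    (\<forall>m\<in>U. preimage_act (q * m) A = preimage_act (q * p) A)"
  shows "A \<in> points (R_obj \<tau> powerset_mset)"
proof -
  have "openin \<tau> {m. preimage_act (q * m) A = preimage_act (q * p) A}" for p q
  proof (subst openin_subopen, intro ballI)
    fix r assume "r \<in> {m. preimage_act (q * m) A = preimage_act (q * p) A}"
    then show "\<exists>U. openin \<tau> U \<and> r \<in> U \<and> U \<subseteq> {m. preimage_act (q * m) A = preimage_act (q * p) A}"
      using assms[of r q] by (auto simp: subset_iff)
  qed
  then show ?thesis
    by (simp add: points_R_powerset preimage_act_comp)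
qed

lemma UNIV_in_R_powerset:
  assumes "topspace \<tau> = UNIV"
  shows "UNIV \<in> points (R_obj \<tau> powerset_mset)"
  using openin_topspace[of \<tau>] assms by (simp add: points_R_powerset preimage_act_def)

text \<open>Inverse images commute with complements, so \<open>A\<close> and \<open>- A\<close> have
  the same stabilisers. This makes the basic open sets closed as well.\<close>

lemma Compl_in_R_powerset:
  assumes "A \<in> points (R_obj \<tau> powerset_mset)"
  shows "- A \<in> points (R_obj \<tau> powerset_mset)"
proof -
  have "preimage_act m (- A) = - preimage_act m A" for m
    by (auto simp: preimage_act_def)
  then show ?thesis
    using assms by (simp add: points_R_powerset preimage_act_comp)
qed

lemma Int_in_R_powerset:
  fixes \<tau> :: "'m::monoid_mult topology"
  assumes "A \<in> points (R_obj \<tau> powerset_mset)" and "B \<in> points (R_obj \<tau> powerset_mset)"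
  shows "A \<inter> B \<in> points (R_obj \<tau> powerset_mset)"
proof (rule R_powersetI)
  fix p q :: 'm
  let ?U = "\<lambda>C :: 'm set. {m. preimage_act (q * m) C = preimage_act (q * p) C}"
  have Int: "preimage_act m (A \<inter> B) = preimage_act m A \<inter> preimage_act m B" for m
    by (auto simp: preimage_act_def)
  have "openin \<tau> (?U A \<inter> ?U B)"
    using assms by (intro openin_Int R_powersetD)
  then show "\<exists>U. openin \<tau> U \<and> p \<in> U \<and>
      (\<forall>m\<in>U. preimage_act (q * m) (A \<inter> B) = preimage_act (q * p) (A \<inter> B))"
    by (intro exI[of _ "?U A \<inter> ?U B"]) (simp add: Int)
qed

text \<open>The topology is left arbitrary so that the lemma serves both for \<open>\<tau>\<close>
  and for any competing topology in the minimality claim.\<close>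

lemma openin_if_stab_open:
  assumes "\<And>p. openin \<sigma> {m. preimage_act m A = preimage_act p A}"
  shows "openin \<sigma> A"
proof (subst openin_subopen, intro ballI)
  fix p assume "p \<in> A"
  then have "{m. preimage_act m A = preimage_act p A} \<subseteq> A"
    using one_in_preimage_act by blast
  then show "\<exists>U. openin \<sigma> U \<and> p \<in> U \<and> U \<subseteq> A"
    using assms[of p] by blast
qed

lemma R_powerset_openin:
  assumes "A \<in> points (R_obj \<tau> powerset_mset)"
  shows "openin \<tau> A"
  by (rule openin_if_stab_open) (use R_powersetD[OF assms, of 1] in simp)

lemma stab_in_R_powerset:
  assumes "topspace \<tau> = UNIV" and "continuous_mset \<tau> X" and x: "x \<in> points X"
  shows "stab X x r \<in> points (R_obj \<tau> powerset_mset)"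
proof (rule R_powersetI)
  fix p q
  have X: "right_mset X" and o: "\<And>y p. y \<in> points X \<Longrightarrow> openin \<tau> (stab X y p)"
    using assms by (auto simp: continuous_mset_iff)
  have act: "act X x (q * m * n) = act X (act X (act X x q) m) n" for m n
    using X x by (simp add: right_mset_def)
  have "openin \<tau> (stab X (act X x q) p)"
    using X x by (intro o) (simp add: right_mset_def)
  then show "\<exists>U. openin \<tau> U \<and> p \<in> U \<and>
      (\<forall>m\<in>U. preimage_act (q * m) (stab X x r) = preimage_act (q * p) (stab X x r))"
    \<comment> \<open>On this neighbourhood \<open>m\<close> and \<open>p\<close> move
      \<open>act X x q\<close> to the same point, so by \<open>act\<close> the two inverse images
      agree.\<close>
    by (intro exI[of _ "stab X (act X x q) p"]) (simp add: stab_def preimage_act_def act)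
qed

text \<open>Both subcategories are full, so their objects determine their morphisms.\<close>

lemma Cont_eq_iff:
  "(Cont \<sigma> :: ('x, 'm::monoid_mult) subcat) = Cont \<tau> \<longleftrightarrow>
     (\<forall>X :: ('x, 'm) mset. continuous_mset \<sigma> X \<longleftrightarrow> continuous_mset \<tau> X)"
  by (auto simp: Cont_def full_subcat_def)

text \<open>Copies an \<open>M\<close>-set along an injection \<open>e\<close>, on whose image
  \<open>inv e\<close> undoes \<open>e\<close>. It brings \<open>M\<close>-sets of subsets of
  \<open>M\<close> into the universe type over which \<open>Cont\<close> is taken.\<close>

definition transport_mset :: "('x \<Rightarrow> 'y) \<Rightarrow> ('x, 'm) mset \<Rightarrow> ('y, 'm) mset" where
  "transport_mset e X = \<lparr>points = e ` points X, act = (\<lambda>y m. e (act X (inv e y) m))\<rparr>"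

lemma continuous_transport_mset:
  assumes e: "inj e" and \<tau>: "topspace \<tau> = UNIV" and X: "right_mset X"
  shows "continuous_mset \<tau> (transport_mset e X) \<longleftrightarrow> continuous_mset \<tau> X"
proof -
  have "right_mset (transport_mset e X)"
    using X e by (simp add: right_mset_def transport_mset_def)
  moreover have "stab (transport_mset e X) (e x) p = stab X x p" for x p
    using e by (simp add: stab_def transport_mset_def inj_eq)
  ultimately show ?thesis
    using X by (simp add: continuous_mset_iff[OF \<tau>]) (simp add: transport_mset_def)
qed

theorem theorem2p6:
  fixes \<tau> :: "'m::monoid_mult topology"
  assumes "topspace \<tau> = UNIV"
    and "T = points (R_obj \<tau> powerset_mset)"
  shows "T = {A. \<forall>p q. openin \<tau>
                {m. preimage_act m (preimage_act q A) = preimage_act p (preimage_act q A)}} \<and>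
    (\<exists>\<tau>' :: 'm topology.
       topspace \<tau>' = UNIV \<and>
       openin \<tau>' = arbitrary union_of (\<lambda>A. A \<in> T) \<and>
       (\<forall>A\<in>T. openin \<tau>' A \<and> closedin \<tau>' A) \<and>
       (\<forall>U. openin \<tau>' U \<longrightarrow> openin \<tau> U) \<and>
       (Cont \<tau>' :: ('u, 'm) subcat) = Cont \<tau> \<and>
       ((\<exists>e :: 'm set \<Rightarrow> 'u. inj e) \<longrightarrow>
          (\<forall>\<sigma>. topspace \<sigma> = UNIV \<and> (Cont \<sigma> :: ('u, 'm) subcat) = Cont \<tau> \<longrightarrow>
            (\<forall>U. openin \<tau>' U \<longrightarrow> openin \<sigma> U))))"
proof -
  define \<tau>' where "\<tau>' = topology (arbitrary union_of (\<lambda>A. A \<in> T))"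
  have open': "openin \<tau>' = arbitrary union_of (\<lambda>A. A \<in> T)"
    \<comment> \<open>Closure of \<open>T\<close> under binary intersections makes the unions of its
      members a topology.\<close>
    unfolding \<tau>'_def using Int_in_R_powerset[of _ \<tau>] assms(2)
    by (intro topology_inverse' istopology_base) auto
  have T_open: "openin \<tau>' A" if "A \<in> T" for A
    using that by (simp add: open' arbitrary_union_of_inc)
  have coarser: "openin \<sigma> U" if T: "\<And>A. A \<in> T \<Longrightarrow> openin \<sigma> A" and "openin \<tau>' U" for \<sigma> U
    using that by (auto simp: open' arbitrary_def union_of_def)
  have top': "topspace \<tau>' = UNIV"
    using openin_subset[OF T_open[of UNIV]] UNIV_in_R_powerset[OF assms(1)] assms(2) by auto
  have clopen: "openin \<tau>' A \<and> closedin \<tau>' A" if "A \<in> T" for A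
    using that T_open Compl_in_R_powerset[of A \<tau>] assms(2)
    by (auto simp: closedin_def top' simp flip: Compl_eq_Diff_UNIV)
  have sub: "openin \<tau> U" if "openin \<tau>' U" for U
    using coarser[of \<tau>, OF _ that] R_powerset_openin assms(2) by blast
  \<comment> \<open>From left to right this is \<open>sub\<close>; conversely, the stabilisers of a
    \<open>\<tau>\<close>-continuous \<open>X\<close> lie in \<open>T\<close>, hence are open in
    \<open>\<tau>'\<close>.\<close>
  have "continuous_mset \<tau>' X \<longleftrightarrow> continuous_mset \<tau> X" for X :: "('u, 'm) mset"
    using sub T_open stab_in_R_powerset[OF assms(1), of X] assms(2)
    by (auto simp: continuous_mset_iff[OF assms(1)] continuous_mset_iff[OF top'])
  then have Cont: "(Cont \<tau>' :: ('u, 'm) subcat) = Cont \<tau>"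
    by (simp add: Cont_eq_iff)
  have least: "openin \<sigma> U"
    if e: "inj (e :: 'm set \<Rightarrow> 'u)" and \<sigma>: "topspace \<sigma> = UNIV"
      and eq: "(Cont \<sigma> :: ('u, 'm) subcat) = Cont \<tau>" and U: "openin \<tau>' U" for e \<sigma> U
  proof (rule coarser[OF _ U])
    let ?R = "R_obj \<tau> (powerset_mset :: ('m set, 'm) mset)"
    have R: "continuous_mset \<tau> ?R"
      by (rule R_continuous[OF assms(1) right_mset_powerset])
    then have mset: "right_mset ?R"
      by (simp add: continuous_mset_def)
    \<comment> \<open>The equality of categories applies to the copy of \<open>?R\<close> in
      \<open>'u\<close>; transport along \<open>e\<close> carries continuity there and back.\<close>
    from R have "continuous_mset \<sigma> ?R"
      using continuous_transport_mset[OF e _ mset] eq assms(1) \<sigma> unfolding Cont_eq_iff by blast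
    then have stab: "openin \<sigma> (stab ?R A p)" if "A \<in> T" for A p
      using that assms(2) by (simp add: continuous_mset_iff[OF \<sigma>])
    show "openin \<sigma> A" if "A \<in> T" for A
      by (rule openin_if_stab_open)
        (use stab[OF that] in \<open>simp add: stab_def R_obj_def powerset_mset_def\<close>)
  qed
  show ?thesis
  proof (intro conjI exI[of _ \<tau>'])
    show "T = {A. \<forall>p q. openin \<tau>
        {m. preimage_act m (preimage_act q A) = preimage_act p (preimage_act q A)}}"
      by (simp add: assms(2) points_R_powerset)
  qed (use top' open' clopen sub Cont least in blast)+
qed

end
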